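(* Let $x=(x_n)_{n\in\mathbf{N}}$ be a sequence taking values in a metric space $X$, let $f:\mathbf{N}\to[0,\infty)$ be a function with $\sum_{n\ge 1}f(n)=\infty$, and let $\mathcal{I}_f:=\{S\subseteq\mathbf{N}:\sum_{n\in S}f(n)<\infty\}$ be the summable ideal generated by $f$. Then the set $\Lambda_x(\mathcal{I}_f)$ of $\mathcal{I}_f$-limit points of $x$ is closed in $X$.
   Context: $\mathbf{N}$ denotes the positive integers. For a family $\mathcal{I}\subseteq\mathcal{P}(\mathbf{N})$ which is an ideal, a point $\ell\in X$ is an $\mathcal{I}$-limit point of $x=(x_n)$ if there is a subsequence $(x_{n_k})$ with $\lim_k x_{n_k}=\ell$ and $\{n_k:k\in\mathbf{N}\}\notin\mathcal{I}$; the set of these is denoted $\Lambda_x(\mathcal{I})$. *)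

theory Defs
  imports "HOL-Analysis.Analysis"
begin

text \<open>Index set: the positive integers \<open>{1..}\<close> of type \<^typ>\<open>nat\<close>; the values of sequences and
  weights at \<open>0\<close> are irrelevant throughout.\<close>

text \<open>For a weight \<open>f \<ge> 0\<close>, \<open>f summable_on S\<close> says exactly that the sum of \<open>f\<close> over \<open>S\<close> is finite.\<close>

definition summable_ideal :: "(nat \<Rightarrow> real) \<Rightarrow> nat set set" where
  "summable_ideal f = {S. S \<subseteq> {1..} \<and> f summable_on S}"

text \<open>A subsequence is given by a strictly increasing \<open>r\<close> with positive values; \<open>r k\<close> is
  the index \<open>n\<^bsub>k+1\<^esub>\<close>.\<close>

definition ideal_limit_points ::
    "nat set set \<Rightarrow> (nat \<Rightarrow> 'a::topological_space) \<Rightarrow> 'a set" where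
  "ideal_limit_points I x =
     {l. \<exists>r. strict_mono r \<and> range r \<subseteq> {1..} \<and> (\<lambda>k. x (r k)) \<longlonglongrightarrow> l \<and> range r \<notin> I}"

end

theory Submission
  imports Defs
begin

text \<open>A point \<open>l\<close> is a limit point along \<open>\<I>\<^sub>f\<close> iff \<open>f\<close> has infinite sum over the indices of
  the terms in each ball around \<open>l\<close>, a condition closed under limits of \<open>l\<close>. For the
  nontrivial direction, divergence yields consecutive blocks \<open>[N\<^sub>j, N\<^sub>j\<^sub>+\<^sub>1)\<close> such that the
  indices in the \<open>j\<close>-th block with \<open>x\<^sub>n\<close> at distance less than \<open>1/(j+1)\<close> from \<open>l\<close> have total
  weight at least \<open>1\<close>. The union of these index sets carries the required subsequence.\<close>

lemma summable_on_from_tail: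
  fixes f :: "nat \<Rightarrow> real"
  assumes "f summable_on (S \<inter> {m..})"
  shows "f summable_on S"
proof -
  have "f summable_on (S \<inter> {m..} \<union> S \<inter> {..<m})"
    by (intro summable_on_Un_disjoint assms summable_on_finite) auto
  moreover have "S \<inter> {m..} \<union> S \<inter> {..<m} = S" by auto
  ultimately show ?thesis by simp
qed

text \<open>If every finite block of \<open>S\<close> starting at \<open>m\<close> had weight below
  1, all finite sums over the tail of \<open>S\<close> would be bounded by 1, and bounded finite
  sums of nonnegative terms force summability.\<close>

lemma not_summable_on_block:
  fixes f :: "nat \<Rightarrow> real"
  assumes nonneg: "\<And>n. n \<in> S \<Longrightarrow> f n \<ge> 0" and "\<not> f summable_on S"
  shows "\<exists>M>m. sum f (S \<inter> {m..<M}) \<ge> 1"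
proof (rule ccontr)
  assume contra: "\<not> ?thesis"
  have "sum f F \<le> 1" if F: "F \<subseteq> S \<inter> {m..}" "finite F" for F
  proof -
    obtain M where M: "F \<subseteq> {..<M}" using finite_nat_bounded[OF F(2)] by blast
    \<comment> \<open>The negated claim only speaks of right ends above \<open>m\<close>, hence the
      maximum with \<open>Suc m\<close>.\<close>
    have "sum f F \<le> sum f (S \<inter> {m..<max M (Suc m)})"
    proof (rule sum_mono2)
      show "F \<subseteq> S \<inter> {m..<max M (Suc m)}" using F(1) M by fastforce
    qed (auto simp: nonneg)
    also have "\<dots> \<le> 1"
      using contra by (auto simp: not_le intro!: less_imp_le)
    finally show ?thesis .
  qed
  then have "bdd_above (sum f ` {F. F \<subseteq> S \<inter> {m..} \<and> finite F})"
    by (intro bdd_aboveI2[where M=1]) auto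
  then have "f summable_on (S \<inter> {m..})"
    by (intro nonneg_bdd_above_summable_on) (auto simp: nonneg)
  then show False using summable_on_from_tail assms(2) by blast
qed

text \<open>Each block starts where the previous one ends, so the blocks are disjoint and each adds
  weight at least 1, although the set \<open>S j\<close> may change with \<open>j\<close>.\<close>

lemma not_summable_on_diagonal_union:
  fixes f :: "nat \<Rightarrow> real" and S :: "nat \<Rightarrow> nat set"
  assumes nonneg: "\<And>j n. n \<in> S j \<Longrightarrow> f n \<ge> 0"
    and nsum: "\<And>j. \<not> f summable_on S j"
  obtains N where "strict_mono N"
    and "\<not> f summable_on (\<Union>j. S j \<inter> {N j..<N (Suc j)})"
proof -
  \<comment> \<open>\<open>True\<close> fills the invariant of \<open>dependent_nat_choice\<close>:
    any \<open>N j\<close> can be continued.\<close>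
  have "\<exists>N. \<forall>j. True \<and> N j < N (Suc j) \<and> sum f (S j \<inter> {N j..<N (Suc j)}) \<ge> 1"
    using not_summable_on_block[OF nonneg nsum]
    by (intro dependent_nat_choice) auto
  then obtain N where N: "\<And>j. N j < N (Suc j)"
    and block: "\<And>j. sum f (S j \<inter> {N j..<N (Suc j)}) \<ge> 1" by blast
  have mono: "strict_mono N" using N by (simp add: strict_mono_Suc_iff)
  let ?A = "\<Union>j. S j \<inter> {N j..<N (Suc j)}"
  have "sum f (?A \<inter> {..<N k}) \<ge> real k" for k
  proof (induction k)
    case 0
    show ?case using nonneg by (auto intro!: sum_nonneg)
  next
    case (Suc k)
    have "real (Suc k) \<le> sum f (?A \<inter> {..<N k}) + sum f (S k \<inter> {N k..<N (Suc k)})"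
      using Suc block[of k] by simp
    also have "\<dots> = sum f (?A \<inter> {..<N k} \<union> S k \<inter> {N k..<N (Suc k)})"
      by (rule sum.union_disjoint[symmetric]) auto
    also have "\<dots> \<le> sum f (?A \<inter> {..<N (Suc k)})"
      using N[of k] by (intro sum_mono2) (auto simp: nonneg)
    finally show ?case .
  qed
  \<comment> \<open>If \<open>f\<close> were summable on the union, its sum would be an upper bound
    for all natural numbers.\<close>
  moreover have "sum f (?A \<inter> {..<N k}) \<le> infsum f ?A" if "f summable_on ?A" for k
    using that by (intro finite_sum_le_infsum) (auto simp: nonneg)
  ultimately have "real k \<le> infsum f ?A" if "f summable_on ?A" for k
    using that order_trans by blast
  then have "\<not> f summable_on ?A"
    using reals_Archimedean2[of "infsum f ?A"] by (meson not_le)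
  then show thesis using that mono by blast
qed

lemma ideal_limit_points_summable_ideal_iff:
  fixes x :: "nat \<Rightarrow> 'a::metric_space" and f :: "nat \<Rightarrow> real"
  assumes nonneg: "\<And>n. n \<ge> 1 \<Longrightarrow> f n \<ge> 0"
  shows "l \<in> ideal_limit_points (summable_ideal f) x \<longleftrightarrow>
         (\<forall>e>0. \<not> f summable_on {n. n \<ge> 1 \<and> dist (x n) l < e})"
proof (intro iffI allI impI notI)
  fix e :: real
  assume e: "e > 0" and sm: "f summable_on {n. n \<ge> 1 \<and> dist (x n) l < e}"
  assume "l \<in> ideal_limit_points (summable_ideal f) x"
  then obtain r where r: "strict_mono r" "range r \<subseteq> {1..}" "(\<lambda>k. x (r k)) \<longlonglongrightarrow> l"
    "\<not> f summable_on range r"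
    by (auto simp: ideal_limit_points_def summable_ideal_def)
  obtain K where K: "\<And>k. k \<ge> K \<Longrightarrow> dist (x (r k)) l < e"
    using metric_LIMSEQ_D[OF r(3) e] by blast
  \<comment> \<open>Since \<open>r\<close> is strictly increasing, cutting off the values below
    \<open>r K\<close> leaves exactly the terms with \<open>k \<ge> K\<close>.\<close>
  have "range r \<inter> {r K..} \<subseteq> {n. n \<ge> 1 \<and> dist (x n) l < e}"
    using r(2) K by (auto simp: strict_mono_less_eq[OF r(1)])
  then have "f summable_on (range r \<inter> {r K..})"
    using sm summable_on_subset_banach by blast
  then show False using r(4) summable_on_from_tail by blast
next
  assume nsum: "\<forall>e>0. \<not> f summable_on {n. n \<ge> 1 \<and> dist (x n) l < e}"
  define S where "S j = {n. n \<ge> 1 \<and> dist (x n) l < 1 / real (Suc j)}" for j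
  obtain N where N: "strict_mono N"
    and nA: "\<not> f summable_on (\<Union>j. S j \<inter> {N j..<N (Suc j)})"
    using not_summable_on_diagonal_union[of S f] nsum nonneg by (auto simp: S_def)
  define A where "A = (\<Union>j. S j \<inter> {N j..<N (Suc j)})"
  have nA: "\<not> f summable_on A" using nA by (simp add: A_def)
  then have inf: "infinite A" using summable_on_finite by blast
  have "(\<lambda>k. x (enumerate A k)) \<longlonglongrightarrow> l"
  proof (rule metric_LIMSEQ_I)
    fix e :: real
    assume "e > 0"
    then obtain j where j: "1 / real (Suc j) < e" using nat_approx_posE by blast
    have "dist (x (enumerate A k)) l < e" if k: "k \<ge> N j" for k
    proof -
      obtain i where i: "enumerate A k \<in> S i" "enumerate A k < N (Suc i)"
        using enumerate_in_set[OF inf, of k] by (auto simp: A_def)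
      \<comment> \<open>As \<open>k \<le> enumerate A k\<close>, late terms of the enumeration lie
        in late blocks, where the radius is small.\<close>
      have "N j < N (Suc i)" using k i(2) le_enumerate[OF inf, of k] by linarith
      then have "j \<le> i" using strict_mono_less[OF N] by simp
      then have "1 / real (Suc i) \<le> 1 / real (Suc j)" by (simp add: frac_le)
      then show ?thesis using i(1) j by (simp add: S_def)
    qed
    then show "\<exists>n0. \<forall>k\<ge>n0. dist (x (enumerate A k)) l < e" by blast
  qed
  moreover have "A \<subseteq> {1..}" by (auto simp: A_def S_def)
  ultimately show "l \<in> ideal_limit_points (summable_ideal f) x"
    using nA strict_mono_enumerate[OF inf] range_enumerate[OF inf]
    by (auto simp: ideal_limit_points_def summable_ideal_def intro!: exI[of _ "enumerate A"])
qed

theorem theorem3p4: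
  fixes x :: "nat \<Rightarrow> 'a::metric_space" and f :: "nat \<Rightarrow> real"
  assumes "\<And>n. n \<ge> 1 \<Longrightarrow> f n \<ge> 0"
    and "\<not> f summable_on {1..}"
  shows "closed (ideal_limit_points (summable_ideal f) x)"
proof -
  let ?L = "ideal_limit_points (summable_ideal f) x"
  have iff: "l \<in> ?L \<longleftrightarrow> (\<forall>e>0. \<not> f summable_on {n. n \<ge> 1 \<and> dist (x n) l < e})" for l
    using assms(1) by (rule ideal_limit_points_summable_ideal_iff)
  have "l \<in> ?L" if l: "l \<in> closure ?L" for l
    unfolding iff
  proof (intro allI impI notI)
    fix e :: real
    assume e: "e > 0" and sm: "f summable_on {n. n \<ge> 1 \<and> dist (x n) l < e}"
    obtain l' where l': "l' \<in> ?L" "dist l' l < e / 2"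
      using l e unfolding closure_approachable by (meson half_gt_zero)
    \<comment> \<open>The half-radius ball around \<open>l'\<close> lies in the
      \<open>e\<close>-ball around \<open>l\<close>, so summability passes down to it.\<close>
    have "{n. n \<ge> 1 \<and> dist (x n) l' < e / 2} \<subseteq> {n. n \<ge> 1 \<and> dist (x n) l < e}"
      using l'(2) by (auto intro: dist_triangle_half_l simp del: less_divide_eq_numeral1 simp: dist_commute[of l' l])
    then have "f summable_on {n. n \<ge> 1 \<and> dist (x n) l' < e / 2}"
      using sm summable_on_subset_banach by blast
    then show False using l'(1) e iff by (meson half_gt_zero)
  qed
  then show ?thesis by (metis closure_subset closure_eq subsetI subset_antisym)
qed

end
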